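(* Let $C\subset\mathbb{Z}_2^n$ be a $5$-cap and let $y$ be the sum of the five elements of $C$. Then: (a) $\mathrm{qc}(C)\cup\{y\}$ is a $4$-flat, and $y\notin\mathrm{qc}(C)$ (the union is disjoint); (b) $C$ is not complete, and $C$ is not contained in any flat of dimension less than $4$; (c) every point of $\mathrm{exc}(C\cup\{y\})$ has multiplicity $2$ with respect to $C\cup\{y\}$.
   Context: $\mathbb{Z}_2^n$ is the $n$-dimensional vector space over $\mathbb{Z}_2$. A quad is a set of four distinct elements $a,b,c,d$ with $a+b+c+d=\vec 0$; a cap is a subset containing no quad; a $k$-cap is a cap with $k$ elements. A cap $C$ is complete if adding any other element of $\mathbb{Z}_2^n$ to $C$ yields a set that is not a cap. For $S\subset\mathbb{Z}_2^n$, $\mathrm{exc}(S)=\{a+b+c: a,b,c\in S\text{ distinct}\}$ and $\mathrm{qc}(S)=S\cup\mathrm{exc}(S)$; the multiplicity of $p\in\mathrm{exc}(S)$ is the number of $3$-element subsets $\{x,y,z\}\subset S$ with $x+y+z=p$. An $r$-flat is an $r$-dimensional affine subspace of $\mathbb{Z}_2^n$ (it has $2^r$ points). *)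

theory Defs
  imports "HOL-Analysis.Cartesian_Space" "HOL-Library.Z2"
begin

text \<open>
  The space of dimension \<open>n\<close> over the two-element field is \<^typ>\<open>bit ^ 'n\<close> with
  \<open>n = CARD('n)\<close>. Linear notions are those of the interpretation \<open>vec\<close> of vector spaces
  for componentwise scaling over an arbitrary field; the constants \<open>subspace\<close>, \<open>dim\<close> and
  \<open>affine\<close> without the prefix \<open>vec\<close> are about real scalars.
\<close>

definition quad :: "(bit ^ 'n) set \<Rightarrow> bool" where
  "quad Q \<longleftrightarrow>
    (\<exists>a b c d. distinct [a, b, c, d] \<and> Q = {a, b, c, d} \<and> a + b + c + d = 0)"

definition cap :: "(bit ^ 'n) set \<Rightarrow> bool" where
  "cap C \<longleftrightarrow> \<not> (\<exists>Q. Q \<subseteq> C \<and> quad Q)"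

definition k_cap :: "nat \<Rightarrow> (bit ^ 'n) set \<Rightarrow> bool" where
  "k_cap k C \<longleftrightarrow> cap C \<and> card C = k"

definition complete_cap :: "(bit ^ 'n) set \<Rightarrow> bool" where
  "complete_cap C \<longleftrightarrow> cap C \<and> (\<forall>x. x \<notin> C \<longrightarrow> \<not> cap (C \<union> {x}))"

definition exc :: "(bit ^ 'n) set \<Rightarrow> (bit ^ 'n) set" where
  "exc S = {a + b + c | a b c. a \<in> S \<and> b \<in> S \<and> c \<in> S \<and> distinct [a, b, c]}"

definition qc :: "(bit ^ 'n) set \<Rightarrow> (bit ^ 'n) set" where
  "qc S = S \<union> exc S"

definition multiplicity_exc :: "(bit ^ 'n) set \<Rightarrow> bit ^ 'n \<Rightarrow> nat" where
  "multiplicity_exc S p = card {T. T \<subseteq> S \<and> card T = 3 \<and> \<Sum>T = p}"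

definition flat :: "nat \<Rightarrow> (bit ^ 'n) set \<Rightarrow> bool" where
  "flat r F \<longleftrightarrow>
    (\<exists>a W. vec.subspace W \<and> vec.dim W = r \<and> F = (\<lambda>w. a + w) ` W)"

end

theory Submission
  imports Defs
begin

text \<open>
  Over the two-element field, the sums of two subsets add up to the sum of their symmetric
  difference, and no nonempty subset of even size at most 4 of a cap has sum 0. Hence distinct
  odd subsets of a 5-cap \<open>C\<close> have distinct sums, and these sums form \<open>qc C \<union> {y}\<close>.
  Translating an element \<open>a\<close> of \<open>C\<close> to the origin turns the other four elements into an
  independent set and the odd subset sums into its span. Finally, \<open>C \<union> {y}\<close> is a 6-cap with
  sum 0, so a 3-subset shares its sum with its complement and with no other 3-subset.
\<close>

section \<open>Subset sums in characteristic two\<close>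

lemma add_self_bit_vec: "x + x = 0" for x :: "bit ^ 'n"
  by (simp add: vec_eq_iff)

lemma add_self_left_bit_vec: "x + (x + y) = y" for x :: "bit ^ 'n"
  by (simp add: add.assoc [symmetric] add_self_bit_vec)

lemma add_eq_0_bit_vec: "x + y = 0 \<longleftrightarrow> x = y" for x :: "bit ^ 'n"
  by (metis add_self_bit_vec add_self_left_bit_vec add.right_neutral)

text \<open>The terms over \<open>A \<inter> B\<close> occur twice on the right and cancel.\<close>

lemma sum_sym_diff_bit_vec:
  fixes f :: "'a \<Rightarrow> bit ^ 'n"
  assumes "finite A" "finite B"
  shows "sum f (sym_diff A B) = sum f A + sum f B"
proof -
  have "sum f A = sum f (A - B) + sum f (A \<inter> B)"
    using sum.Int_Diff [OF assms(1), of f B] by (simp add: add.commute)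
  moreover have "sum f B = sum f (B - A) + sum f (A \<inter> B)"
    using sum.Int_Diff [OF assms(2), of f A] by (simp add: add.commute Int_commute)
  moreover have "sum f (sym_diff A B) = sum f (A - B) + sum f (B - A)"
    using assms by (intro sum.union_disjoint) auto
  ultimately show ?thesis
    by (simp add: ac_simps add_self_left_bit_vec add_self_bit_vec)
qed

lemma card_sym_diff:
  assumes "finite A" "finite B"
  shows "card (sym_diff A B) + 2 * card (A \<inter> B) = card A + card B"
proof -
  have "card (sym_diff A B) = card (A - B) + card (B - A)"
    using assms by (intro card_Un_disjoint) auto
  moreover have "card A = card (A - B) + card (A \<inter> B)"
    using assms card_Int_Diff [of A B] by simp
  moreover have "card B = card (B - A) + card (A \<inter> B)"
    using assms card_Int_Diff [of B A] by (simp add: Int_commute)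
  ultimately show ?thesis by simp
qed

text \<open>The copies of \<open>a\<close> cancel in pairs, so only the parity of their number is
  left. This is the source of the parity splits in later proofs.\<close>

lemma sum_translate_bit_vec:
  fixes a :: "bit ^ 'n"
  assumes "finite U"
  shows "(\<Sum>x\<in>U. a + x) = (if odd (card U) then a else 0) + \<Sum>U"
  using assms
  by (induction U rule: finite_induct)
    (auto simp: ac_simps add_self_left_bit_vec add_self_bit_vec)

section \<open>Spans and independence over the two-element field\<close>

lemma sum_scale_bit_vec:
  fixes B :: "(bit ^ 'n) set"
  assumes "finite B"
  shows "(\<Sum>v\<in>B. u v *s v) = \<Sum>{v \<in> B. u v = 1}"
proof -
  have "u v *s v = (if u v = 1 then v else 0)" for v
    by (cases "u v") auto
  then show ?thesis
    using assms by (simp add: sum.inter_filter)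
qed

text \<open>A coefficient is 0 or 1, so a linear combination just selects a subset to be
  summed.\<close>

lemma span_bit_vec:
  fixes B :: "(bit ^ 'n) set"
  assumes "finite B"
  shows "vec.span B = sum id ` Pow B"
proof (intro equalityI subsetI)
  fix w assume "w \<in> vec.span B"
  then obtain u where "w = (\<Sum>v\<in>B. u v *s v)"
    using assms by (auto simp: vec.span_finite)
  then have "w = sum id {v \<in> B. u v = 1}"
    using assms by (simp add: sum_scale_bit_vec)
  then show "w \<in> sum id ` Pow B" by blast
next
  fix w assume "w \<in> sum id ` Pow B"
  then obtain T where "T \<subseteq> B" "w = \<Sum>T" by auto
  then show "w \<in> vec.span B"
    by (auto intro: vec.span_sum vec.span_base)
qed

text \<open>A nontrivial linear relation selects a nonempty subset with sum 0, namely the vectors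
  with coefficient 1.\<close>

lemma independent_bit_vec:
  fixes B :: "(bit ^ 'n) set"
  assumes "finite B" and "\<And>T. T \<subseteq> B \<Longrightarrow> \<Sum>T = 0 \<Longrightarrow> T = {}"
  shows "vec.independent B"
proof
  assume "vec.dependent B"
  then obtain u where u: "\<exists>v\<in>B. u v \<noteq> 0" "(\<Sum>v\<in>B. u v *s v) = 0"
    using assms(1) by (auto simp: vec.dependent_finite)
  then have "\<Sum>{v \<in> B. u v = 1} = 0"
    using assms(1) by (simp add: sum_scale_bit_vec)
  then have "{v \<in> B. u v = 1} = {}"
    by (intro assms(2)) auto
  with u(1) show False
    by auto
qed

section \<open>Caps in terms of subset sums\<close>

lemma in_exc_iff:
  "p \<in> exc S \<longleftrightarrow> (\<exists>T. T \<subseteq> S \<and> card T = 3 \<and> p = \<Sum>T)"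
proof
  assume "p \<in> exc S"
  then obtain a b c where "p = a + b + c" "{a, b, c} \<subseteq> S" "distinct [a, b, c]"
    by (auto simp: exc_def)
  then show "\<exists>T. T \<subseteq> S \<and> card T = 3 \<and> p = \<Sum>T"
    by (intro exI [of _ "{a, b, c}"]) (auto simp: add.assoc)
next
  assume "\<exists>T. T \<subseteq> S \<and> card T = 3 \<and> p = \<Sum>T"
  then obtain a b c where "{a, b, c} \<subseteq> S" "distinct [a, b, c]" "p = \<Sum>{a, b, c}"
    by (auto simp: card_3_iff)
  then show "p \<in> exc S"
    unfolding exc_def by (intro CollectI exI [of _ a] exI [of _ b] exI [of _ c])
      (auto simp: add.assoc)
qed

lemma quad_iff: "quad Q \<longleftrightarrow> card Q = 4 \<and> \<Sum>Q = 0"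
proof
  assume "quad Q"
  then show "card Q = 4 \<and> \<Sum>Q = 0"
    by (auto simp: quad_def add.assoc)
next
  assume *: "card Q = 4 \<and> \<Sum>Q = 0"
  then have "card Q = Suc 3"
    by simp
  then obtain a R where R: "Q = insert a R" "a \<notin> R" "card R = 3"
    unfolding card_Suc_eq by blast
  then obtain b c d where "R = {b, c, d}" "distinct [b, c, d]"
    by (auto simp: card_3_iff)
  with R have "Q = {a, b, c, d}" "distinct [a, b, c, d]"
    by auto
  moreover from this have "a + b + c + d = 0"
    using * by (simp add: add.assoc)
  ultimately show "quad Q"
    unfolding quad_def by blast
qed

text \<open>The size can only be 0, 2 or 4. Two elements with sum 0 would be equal, and four would
  form a quad.\<close>

lemma cap_even_sum_eq_0:
  fixes S :: "(bit ^ 'n) set"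
  assumes "cap S" "T \<subseteq> S" "finite T" "even (card T)" "card T \<le> 5" "\<Sum>T = 0"
  shows "T = {}"
proof -
  have "card T \<noteq> 4"
    using assms by (auto simp: cap_def quad_iff)
  moreover have "card T \<noteq> 2"
  proof
    assume "card T = 2"
    then obtain x y where "T = {x, y}" "x \<noteq> y"
      by (auto simp: card_2_iff)
    with assms(6) show False
      by (simp add: add_eq_0_bit_vec)
  qed
  moreover have "card T \<in> {0, 1, 2, 3, 4, 5}"
    using assms(5) by auto
  ultimately have "card T = 0"
    using assms(4) by auto
  then show ?thesis
    using assms(3) by simp
qed

text \<open>Equal sums give the symmetric difference the sum 0, and equal parities give it even
  size, so it is empty by \<open>cap_even_sum_eq_0\<close>.\<close>

lemma cap_sum_inj:
  fixes S :: "(bit ^ 'n) set"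
  assumes "cap S" "finite S" "T \<subseteq> S" "U \<subseteq> S" "\<Sum>T = \<Sum>U"
    and "even (card T + card U)" "card (sym_diff T U) \<le> 5"
  shows "T = U"
proof -
  have fin: "finite T" "finite U"
    using assms finite_subset by blast+
  have "even (card (sym_diff T U))"
    using card_sym_diff [OF fin] assms(6) by presburger
  moreover have "\<Sum>(sym_diff T U) = 0"
    using sum_sym_diff_bit_vec [OF fin, of "\<lambda>x. x"] assms(5) by (simp add: add_self_bit_vec)
  ultimately have "sym_diff T U = {}"
    using assms fin by (intro cap_even_sum_eq_0 [OF assms(1)]) auto
  then show ?thesis by blast
qed

section \<open>Odd subset sums as a translated span\<close>

lemma qc_Un_sum_eq_odd_sums:
  fixes C :: "(bit ^ 'n) set"
  assumes "card C = 5"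
  shows "qc C \<union> {\<Sum>C} = sum id ` {T. T \<subseteq> C \<and> odd (card T)}"
proof (intro equalityI subsetI)
  fix p assume "p \<in> qc C \<union> {\<Sum>C}"
  then consider "p \<in> C" | "p \<in> exc C" | "p = \<Sum>C"
    by (auto simp: qc_def)
  then show "p \<in> sum id ` {T. T \<subseteq> C \<and> odd (card T)}"
  proof cases
    case 1
    then show ?thesis by (intro image_eqI [of _ _ "{p}"]) auto
  next
    case 2
    then show ?thesis by (auto simp: in_exc_iff)
  next
    case 3
    then show ?thesis using assms by auto
  qed
next
  fix p assume "p \<in> sum id ` {T. T \<subseteq> C \<and> odd (card T)}"
  then obtain T where T: "T \<subseteq> C" "odd (card T)" "p = \<Sum>T"
    by auto
  have fin: "finite C"
    using assms card.infinite by fastforce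
  then have "card T \<le> 5"
    using T(1) assms card_mono by fastforce
  then have "card T \<in> {0, 1, 2, 3, 4, 5}"
    by auto
  \<comment> \<open>The three odd sizes correspond to \<open>C\<close>, \<open>exc C\<close> and the
    total sum.\<close>
  then consider "card T = 1" | "card T = 3" | "card T = 5"
    using T(2) by auto
  then show "p \<in> qc C \<union> {\<Sum>C}"
  proof cases
    case 1
    then show ?thesis using T by (auto simp: card_1_singleton_iff qc_def)
  next
    case 2
    then show ?thesis using T by (auto simp: in_exc_iff qc_def)
  next
    case 3
    then have "T = C"
      using T(1) fin assms card_subset_eq by metis
    then show ?thesis using T by simp
  qed
qed

lemma odd_sums_eq_translated_span:
  fixes C :: "(bit ^ 'n) set"
  assumes "finite C" "a \<in> C"
  shows "sum id ` {T. T \<subseteq> C \<and> odd (card T)} =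
    (+) a ` vec.span ((+) a ` (C - {a}))"
proof (intro equalityI subsetI)
  fix p assume "p \<in> sum id ` {T. T \<subseteq> C \<and> odd (card T)}"
  then obtain T where T: "T \<subseteq> C" "odd (card T)" "p = \<Sum>T"
    by auto
  have fin: "finite T"
    using T(1) assms(1) finite_subset by blast
  \<comment> \<open>If \<open>a\<close> is in \<open>T\<close>, the rest has even size, its copies
    of \<open>a\<close> cancel, and the leading \<open>a\<close> supplies the removed element.
    Otherwise one copy of \<open>a\<close> survives in the sum and cancels the leading one.\<close>
  have "p = a + (\<Sum>x\<in>T - {a}. a + x)"
  proof (cases "a \<in> T")
    case True
    then have "even (card (T - {a}))" "\<Sum>T = a + \<Sum>(T - {a})"
      using T(2) fin by (auto simp: sum.remove)
    then show ?thesis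
      using fin T(3) by (simp add: sum_translate_bit_vec)
  next
    case False
    then show ?thesis
      using fin T by (simp add: sum_translate_bit_vec add_self_left_bit_vec)
  qed
  moreover have "(\<Sum>x\<in>T - {a}. a + x) \<in> vec.span ((+) a ` (C - {a}))"
    using T(1) by (intro vec.span_sum vec.span_base) auto
  ultimately show "p \<in> (+) a ` vec.span ((+) a ` (C - {a}))"
    by blast
next
  fix p assume "p \<in> (+) a ` vec.span ((+) a ` (C - {a}))"
  then obtain w where w: "w \<in> vec.span ((+) a ` (C - {a}))" "p = a + w"
    by blast
  then obtain T where "T \<subseteq> (+) a ` (C - {a})" "w = \<Sum>T"
    using assms(1) by (auto simp: span_bit_vec)
  then obtain U where U: "U \<subseteq> C - {a}" "w = \<Sum>((+) a ` U)"
    by (auto simp: subset_image_iff)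
  have fin: "finite U"
    using U(1) assms(1) by (meson finite_Diff finite_subset)
  have "w = (\<Sum>x\<in>U. a + x)"
    using U(2) by (simp add: sum.reindex)
  then have p: "p = a + ((if odd (card U) then a else 0) + \<Sum>U)"
    using w(2) fin by (simp add: sum_translate_bit_vec)
  have "\<exists>V. V \<subseteq> C \<and> odd (card V) \<and> p = \<Sum>V"
  proof (cases "odd (card U)")
    case True
    then show ?thesis
      using p U(1) by (intro exI [of _ U]) (auto simp: add_self_left_bit_vec)
  next
    case False
    moreover have "a \<notin> U"
      using U(1) by blast
    \<comment> \<open>No copy of \<open>a\<close> survives inside the sum, so the leading
      \<open>a\<close> becomes an element of the set and makes its size odd.\<close>
    ultimately show ?thesis
      using p U(1) fin assms(2) by (intro exI [of _ "insert a U"]) auto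
  qed
  then show "p \<in> sum id ` {T. T \<subseteq> C \<and> odd (card T)}"
    by auto
qed

text \<open>A vanishing sum of translates is a vanishing sum over an even subset of
  \<open>C\<close>, once \<open>a\<close> is added where parity demands it.\<close>

lemma cap_translate_independent:
  fixes C :: "(bit ^ 'n) set"
  assumes "cap C" "finite C" "card C \<le> 5" "a \<in> C"
  shows "vec.independent ((+) a ` (C - {a}))"
proof (rule independent_bit_vec)
  show "finite ((+) a ` (C - {a}))"
    using assms(2) by simp
next
  fix T assume "T \<subseteq> (+) a ` (C - {a})" and T0: "\<Sum>T = 0"
  then obtain U where U: "U \<subseteq> C - {a}" "T = (+) a ` U"
    by (auto simp: subset_image_iff)
  have fin: "finite U" and a: "a \<notin> U"
    using U(1) assms(2) by (auto intro: finite_subset)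
  \<comment> \<open>The surviving copy of \<open>a\<close>, present for odd \<open>card U\<close>,
    is absorbed as an element. An empty \<open>V\<close> forces the even case, hence an empty
    \<open>U\<close>.\<close>
  define V where "V = (if odd (card U) then insert a U else U)"
  have V: "V \<subseteq> C" "finite V" "even (card V)"
    using U(1) fin a assms(4) by (auto simp: V_def)
  have "(\<Sum>x\<in>U. a + x) = 0"
    using T0 U(2) by (simp add: sum.reindex)
  then have "\<Sum>V = 0"
    using fin a by (simp add: V_def sum_translate_bit_vec split: if_splits)
  moreover have "card V \<le> 5"
    using card_mono [OF assms(2) V(1)] assms(3) by simp
  ultimately have "V = {}"
    using cap_even_sum_eq_0 [OF assms(1)] V by blast
  then show "T = {}"
    using U(2) by (auto simp: V_def split: if_splits)
qed

section \<open>Dimension of a flat containing a cap\<close>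

lemma flat_dim_ge:
  fixes F :: "(bit ^ 'n) set"
  assumes "flat r F" "C \<subseteq> F" "a \<in> C" "finite C"
    and "vec.independent ((+) a ` (C - {a}))"
  shows "card C \<le> Suc r"
proof -
  obtain b W where W: "vec.subspace W" "vec.dim W = r" "F = (+) b ` W"
    using assms(1) by (auto simp: flat_def)
  \<comment> \<open>Sums are differences here, so the base point \<open>b\<close> cancels and the
    direction space \<open>W\<close> contains all the translates.\<close>
  have "a + x \<in> W" if x: "x \<in> C" for x
  proof -
    obtain v w where "v \<in> W" "w \<in> W" "a = b + v" "x = b + w"
      using x assms(2,3) W(3) by blast
    then have "a + x = v + w"
      by (simp add: ac_simps add_self_left_bit_vec)
    then show ?thesis
      using \<open>v \<in> W\<close> \<open>w \<in> W\<close> W(1) by (simp add: vec.subspace_add)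
  qed
  then have "(+) a ` (C - {a}) \<subseteq> W"
    by blast
  then have "card ((+) a ` (C - {a})) \<le> r"
    using vec.independent_card_le_dim assms(5) W(2) by blast
  then show ?thesis
    using assms(3,4) by (simp add: card_image)
qed

section \<open>Enlarging a cap, and 6-caps with sum 0\<close>

lemma cap_insert:
  fixes C :: "(bit ^ 'n) set"
  assumes "cap C" "y \<notin> qc C"
  shows "cap (C \<union> {y})"
  unfolding cap_def
proof
  assume "\<exists>Q. Q \<subseteq> C \<union> {y} \<and> quad Q"
  then obtain Q where Q: "Q \<subseteq> C \<union> {y}" "card Q = 4" "\<Sum>Q = 0"
    by (auto simp: quad_iff)
  then have fin: "finite Q"
    using card.infinite by fastforce
  \<comment> \<open>A quad avoiding \<open>y\<close> would lie in the cap \<open>C\<close>. With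
    \<open>y\<close> in it, the other three elements sum to \<open>y\<close>, which puts
    \<open>y\<close> in \<open>exc C\<close>.\<close>
  have "y \<in> Q"
    using Q assms(1) by (auto simp: cap_def quad_iff)
  then have "card (Q - {y}) = 3" "y + \<Sum>(Q - {y}) = 0"
    using Q fin sum.remove [of Q y "\<lambda>x. x"] by simp_all
  moreover have "Q - {y} \<subseteq> C"
    using Q(1) by blast
  ultimately have "y \<in> exc C"
    by (auto simp: in_exc_iff add_eq_0_bit_vec)
  with assms(2) show False
    by (simp add: qc_def)
qed

text \<open>As the total is 0, a 3-subset and its complement have the same sum. Any further 3-subset
  would meet the first one without being equal to it, and injectivity of sums excludes this.\<close>

lemma six_cap_multiplicity:
  fixes S :: "(bit ^ 'n) set"
  assumes "cap S" "card S = 6" "\<Sum>S = 0" "p \<in> exc S"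
  shows "multiplicity_exc S p = 2"
proof -
  have fin: "finite S"
    using assms(2) card.infinite by fastforce
  obtain T where T: "T \<subseteq> S" "card T = 3" "p = \<Sum>T"
    using assms(4) by (auto simp: in_exc_iff)
  have finT: "finite T"
    using T(1) fin finite_subset by blast
  have co: "card (S - T) = 3"
    using T fin finT assms(2) by (simp add: card_Diff_subset)
  have "\<Sum>(S - T) + \<Sum>T = 0"
    using sum.subset_diff [OF T(1) fin, of "\<lambda>x. x"] assms(3) by simp
  then have sum_co: "\<Sum>(S - T) = p"
    using T(3) by (simp add: add_eq_0_bit_vec)
  have "U = T \<or> U = S - T" if U: "U \<subseteq> S" "card U = 3" "\<Sum>U = p" for U
  proof (cases "U \<inter> T = {}")
    case True
    then have "U \<subseteq> S - T"
      using U(1) by blast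
    then show ?thesis
      using U(2) co fin by (metis card_subset_eq finite_Diff)
  next
    case False
    have finU: "finite U"
      using U(1) fin finite_subset by blast
    then have "card (U \<inter> T) > 0"
      using False by (simp add: card_gt_0_iff)
    \<comment> \<open>A common element brings the size of the symmetric difference from 6 down to at
      most 4, within reach of \<open>cap_sum_inj\<close>.\<close>
    then have "card (sym_diff U T) \<le> 5"
      using card_sym_diff [OF finU finT] U(2) T(2) by linarith
    then have "U = T"
      using U T by (intro cap_sum_inj [OF assms(1) fin]) auto
    then show ?thesis ..
  qed
  then have "{U. U \<subseteq> S \<and> card U = 3 \<and> \<Sum>U = p} = {T, S - T}"
    using T co sum_co by auto
  moreover have "T \<noteq> {}"
    using T(2) by auto
  then have "T \<noteq> S - T"
    by blast
  ultimately show ?thesis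
    by (simp add: multiplicity_exc_def)
qed

theorem theorem5p13:
  fixes C :: "(bit ^ 'n) set" and y :: "bit ^ 'n"
  assumes "k_cap 5 C"
    and "y = (\<Sum>x\<in>C. x)"
  shows "(flat 4 (qc C \<union> {y}) \<and> y \<notin> qc C)
    \<and> (\<not> complete_cap C \<and> (\<forall>r F. r < 4 \<and> flat r F \<longrightarrow> \<not> C \<subseteq> F))
    \<and> (\<forall>p \<in> exc (C \<union> {y}). multiplicity_exc (C \<union> {y}) p = 2)"
proof -
  have C: "cap C" "card C = 5" "finite C"
    using assms(1) card.infinite by (fastforce simp: k_cap_def)+
  obtain a where a: "a \<in> C"
    using C(2) by fastforce
  define B where "B = (+) a ` (C - {a})"
  have ind: "vec.independent B"
    using cap_translate_independent [of C a] C a by (simp add: B_def)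
  have "card B = 4"
    using C a by (simp add: B_def card_image)
  then have "vec.dim (vec.span B) = 4"
    using ind by (simp add: vec.dim_eq_card_independent)
  moreover have "qc C \<union> {y} = (+) a ` vec.span B"
    unfolding B_def assms(2) qc_Un_sum_eq_odd_sums [OF C(2)]
    using odd_sums_eq_translated_span [OF C(3) a] .
  ultimately have flat: "flat 4 (qc C \<union> {y})"
    unfolding flat_def by (intro exI [of _ a] exI [of _ "vec.span B"]) auto
  \<comment> \<open>Sizes 1 and 3 will give \<open>y \<notin> C\<close> and
    \<open>y \<notin> exc C\<close>.\<close>
  have proper: "y \<noteq> \<Sum>T" if T: "T \<subseteq> C" "odd (card T)" "card T < 5" for T
  proof
    assume "y = \<Sum>T"
    moreover have "card (sym_diff T C) \<le> 5"
      using card_mono [OF C(3), of "sym_diff T C"] T(1) C(2) by auto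
    ultimately have "T = C"
      using T C(2) assms(2) by (intro cap_sum_inj [OF C(1,3)]) auto
    with T(3) C(2) show False by simp
  qed
  have "y \<notin> C"
    using proper [of "{y}"] by auto
  moreover have "y \<notin> exc C"
    using proper by (auto simp: in_exc_iff)
  ultimately have notin: "y \<notin> qc C"
    by (simp add: qc_def)
  have cap6: "cap (C \<union> {y})"
    using cap_insert [OF C(1) notin] .
  have "\<not> complete_cap C"
    using cap6 \<open>y \<notin> C\<close> by (auto simp: complete_cap_def)
  moreover have "\<not> C \<subseteq> F" if "r < 4" "flat r F" for r F
    using flat_dim_ge [OF that(2) _ a C(3) ind [unfolded B_def]] that(1) C(2) by auto
  \<comment> \<open>The new element equals the sum of the old ones, so the total is
    \<open>y + y\<close>.\<close>
  moreover have "card (C \<union> {y}) = 6" "\<Sum>(C \<union> {y}) = 0"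
    using C \<open>y \<notin> C\<close> assms(2) by (auto simp: add_self_bit_vec)
  ultimately show ?thesis
    using flat notin six_cap_multiplicity [OF cap6] by blast
qed

end
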